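(* Let $p$ be an odd prime, $\varepsilon\in\{-1,1\}$ and $z\in\mathbb{Z}$ with $\gcd(p,z(z+1))=1$. Then for all $r\in\mathbb{N}$, \[ \sum_{k=0}^{p-1}(2k+1)^{2r+1}\varepsilon^k S_k(z)\equiv 1\pmod{p} \quad\text{and}\quad \sum_{k=0}^{p-1}(2k+1)^{2r+1}\varepsilon^k s_k(z)\equiv 0\pmod{p}. \]
   Context: $\mathbb{N}=\{0,1,2,\dots\}$. The large Schröder polynomials are $S_n(z)=\sum_{k=0}^{n}\binom{n}{k}\binom{n+k}{k}\frac{1}{k+1}z^k$ for $n\in\mathbb{N}$, and the little Schröder polynomials are $s_0(z)=0$ and $s_n(z)=\sum_{k=1}^{n}\frac{1}{n}\binom{n}{k}\binom{n}{k-1}z^{k-1}(z+1)^{n-k}$ for $n\ge 1$. *)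

theory Defs
  imports Complex_Main "HOL-Number_Theory.Cong" "HOL-Computational_Algebra.Primes"
begin

text \<open>The values of the large and little Schroeder polynomials at an integer.
  Every division below is exact, so that these integer-valued functions agree with
  the usual rational formulas; see the lemmas \<open>of_int_large_schroeder\<close> and
  \<open>of_int_little_schroeder\<close>.\<close>

definition large_schroeder :: "nat \<Rightarrow> int \<Rightarrow> int" where
  "large_schroeder n z =
     (\<Sum>k=0..n. int (((n choose k) * ((n + k) choose k)) div (k + 1)) * z ^ k)"

definition little_schroeder :: "nat \<Rightarrow> int \<Rightarrow> int" where
  "little_schroeder n z =
     (if n = 0 then 0
      else (\<Sum>k=1..n. int (((n choose k) * (n choose (k - 1))) div n)
                       * z ^ (k - 1) * (z + 1) ^ (n - k)))"

lemma large_schroeder_coeff_exact: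
  "(k + 1) dvd (n choose k) * ((n + k) choose k)"
proof (cases "k \<le> n")
  case True
  let ?X = "(n choose k) * ((n + k) choose k)"
  have a: "(n - k) * (n choose k) = (k + 1) * (n choose (k + 1))"
    using True binomial_absorb_comp[of n k] binomial_absorption[of k n]
    by (cases n) auto
  have b: "(n + k + 1) * ((n + k) choose k) = (k + 1) * ((n + k + 1) choose (k + 1))"
    using Suc_times_binomial_eq[of "n + k" k] by (simp add: mult.commute)
  have "(n - k) * ?X = (k + 1) * ((n choose (k + 1)) * ((n + k) choose k))"
    by (metis a mult.assoc)
  then have A: "(k + 1) dvd (n - k) * ?X" by (metis dvd_triv_left)
  have "(n + k + 1) * ?X = (k + 1) * (((n + k + 1) choose (k + 1)) * (n choose k))"
    by (metis b mult.assoc mult.commute)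
  then have B: "(k + 1) dvd (n + k + 1) * ?X" by (metis dvd_triv_left)
  have "(n + k + 1) * ?X + ?X = (n - k) * ?X + (k + 1) * (2 * ?X)"
  proof -
    have "n + k + 1 + 1 = (n - k) + (k + 1) * 2" using True by simp
    then have "(n + k + 1 + 1) * ?X = ((n - k) + (k + 1) * 2) * ?X" by (rule arg_cong)
    then show ?thesis by (simp only: distrib_right mult.assoc mult_1)
  qed
  moreover have "(k + 1) dvd (n - k) * ?X + (k + 1) * (2 * ?X)"
    using A by (intro dvd_add dvd_triv_left)
  ultimately show ?thesis using B by (metis dvd_add_right_iff)
qed (simp add: not_le binomial_eq_0)

lemma little_schroeder_coeff_exact:
  assumes "1 \<le> k"
  shows "n dvd (n choose k) * (n choose (k - 1))"
proof -
  let ?X = "(n choose k) * (n choose (k - 1))"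
  have *: "n dvd j * (n choose j)" for j
  proof (cases j)
    case (Suc i)
    then have "j * (n choose j) = n * ((n - 1) choose i)"
      using binomial_absorption[of i "n"] by simp
    then show ?thesis by simp
  qed simp
  have "n dvd k * ?X"
    using *[of k] by (metis dvd_mult2 mult.assoc)
  moreover have "n dvd (k - 1) * ?X"
    using *[of "k - 1"] by (metis dvd_mult mult.left_commute)
  moreover have "k * ?X = (k - 1) * ?X + ?X"
    using assms by (cases k) simp_all
  ultimately show ?thesis by (metis dvd_add_right_iff)
qed

lemma of_nat_exact_div:
  fixes a b :: nat
  assumes "b dvd a"
  shows "(of_nat (a div b) :: 'a :: field_char_0) = of_nat a / of_nat b"
  using assms by (auto elim!: dvdE)

lemma of_int_large_schroeder:
  "(of_int (large_schroeder n z) :: 'a :: field_char_0) =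
     (\<Sum>k=0..n. of_nat (n choose k) * of_nat ((n + k) choose k) * (1 / of_nat (k + 1)) * of_int z ^ k)"
  unfolding large_schroeder_def of_int_sum
proof (rule sum.cong[OF refl])
  fix k
  have "(of_nat (((n choose k) * ((n + k) choose k)) div (k + 1)) :: 'a) =
          of_nat ((n choose k) * ((n + k) choose k)) / of_nat (k + 1)"
    by (rule of_nat_exact_div) (rule large_schroeder_coeff_exact)
  then show "(of_int (int (((n choose k) * ((n + k) choose k)) div (k + 1)) * z ^ k) :: 'a) =
      of_nat (n choose k) * of_nat ((n + k) choose k) * (1 / of_nat (k + 1)) * of_int z ^ k"
    by simp
qed

lemma little_schroeder_0: "little_schroeder 0 z = 0"
  by (simp add: little_schroeder_def)

lemma of_int_little_schroeder:
  assumes "1 \<le> n"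
  shows "(of_int (little_schroeder n z) :: 'a :: field_char_0) =
     (\<Sum>k=1..n. (1 / of_nat n) * of_nat (n choose k) * of_nat (n choose (k - 1))
                 * of_int z ^ (k - 1) * (of_int z + 1) ^ (n - k))"
proof -
  have "(of_int (int (((n choose k) * (n choose (k - 1))) div n)
                       * z ^ (k - 1) * (z + 1) ^ (n - k)) :: 'a) =
      (1 / of_nat n) * of_nat (n choose k) * of_nat (n choose (k - 1))
                 * of_int z ^ (k - 1) * (of_int z + 1) ^ (n - k)" if "k \<in> {1..n}" for k
  proof -
    have "(of_nat (((n choose k) * (n choose (k - 1))) div n) :: 'a) =
            of_nat ((n choose k) * (n choose (k - 1))) / of_nat n"
      using that by (intro of_nat_exact_div little_schroeder_coeff_exact) simp
    then show ?thesis by simp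
  qed
  moreover have "n \<noteq> 0" using assms by simp
  ultimately show ?thesis
    unfolding little_schroeder_def by (simp only: if_False of_int_sum) (intro sum.cong refl)
qed

end

theory Submission
  imports Defs "HOL-Number_Theory.Residues"
begin

text \<open>Write \<open>c n k\<close> for the coefficient of \<open>z ^ k\<close> in the large polynomial of index \<open>n\<close>. The recurrence
  \<open>(k + 1) (k + 2) c n (k + 1) = (n - k) (n + k + 1) c n k\<close> is invariant modulo \<open>p\<close> under
  \<open>n \<mapsto> p - 1 - n\<close>, so \<open>c (p - 1 - n) k\<close> and \<open>c n k\<close> agree modulo \<open>p\<close> for \<open>k \<le> p - 2\<close>. Hence the
  values at \<open>n\<close> and \<open>p - 1 - n\<close> agree for \<open>0 < n < p - 1\<close>, and as \<open>2 n + 1\<close> changes sign under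
  this reflection, these terms cancel in pairs. The term of index \<open>0\<close> is \<open>1\<close>, and that of index
  \<open>p - 1\<close> vanishes by Fermat because \<open>c (p - 1) (p - 1) \<equiv> -1\<close>. The little polynomials
  reduce to the large ones through \<open>S n z = (z + 1) s n z\<close> for \<open>n > 0\<close>, a consequence of
  Vandermonde's identity.\<close>

section \<open>Coefficients of the large polynomials and their reflection symmetry\<close>

definition schroeder_coeff :: "nat \<Rightarrow> nat \<Rightarrow> nat" where
  "schroeder_coeff n k = ((n choose k) * ((n + k) choose k)) div (k + 1)"

lemma Suc_times_schroeder_coeff:
  "(k + 1) * schroeder_coeff n k = (n choose k) * ((n + k) choose k)"
  unfolding schroeder_coeff_def
  using large_schroeder_coeff_exact[of k n] by (rule dvd_mult_div_cancel)

lemma schroeder_coeff_0 [simp]: "schroeder_coeff n 0 = 1"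
  by (simp add: schroeder_coeff_def)

lemma schroeder_coeff_eq_0: "n < k \<Longrightarrow> schroeder_coeff n k = 0"
  by (simp add: schroeder_coeff_def binomial_eq_0)

text \<open>Padding with zero terms puts polynomials of different index over one common range, so
  that they can be compared termwise.\<close>

lemma large_schroeder_altdef:
  assumes "n \<le> N"
  shows "large_schroeder n z = (\<Sum>k=0..N. int (schroeder_coeff n k) * z ^ k)"
proof -
  have "large_schroeder n z = (\<Sum>k=0..n. int (schroeder_coeff n k) * z ^ k)"
    by (simp add: large_schroeder_def schroeder_coeff_def)
  also have "\<dots> = (\<Sum>k=0..N. int (schroeder_coeff n k) * z ^ k)"
    using assms by (intro sum.mono_neutral_left) (auto simp: schroeder_coeff_eq_0)
  finally show ?thesis .
qed

lemma schroeder_coeff_rec: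
  "int ((k + 1) * (k + 2)) * int (schroeder_coeff n (k + 1)) =
     (int n - int k) * (int n + int k + 1) * int (schroeder_coeff n k)"
proof -
  have a: "int (k + 1) * int (n choose (k + 1)) = (int n - int k) * int (n choose k)"
  proof (cases "k \<le> n")
    case True
    have "(k + 1) * (n choose (k + 1)) = (n - k) * (n choose k)"
      using binomial_absorb_comp[of n k] binomial_absorption[of k n] by simp
    then have "int (k + 1) * int (n choose (k + 1)) = int (n - k) * int (n choose k)"
      by (metis of_nat_mult)
    then show ?thesis using True by (simp add: of_nat_diff)
  qed (simp add: binomial_eq_0)
  have "(k + 1) * ((n + (k + 1)) choose (k + 1)) = (n + k + 1) * ((n + k) choose k)"
    using Suc_times_binomial_eq[of "n + k" k] by (simp add: mult.commute)
  then have b: "int (k + 1) * int ((n + (k + 1)) choose (k + 1)) =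
      (int n + int k + 1) * int ((n + k) choose k)"
    by (metis of_nat_add of_nat_mult of_nat_1)
  have c: "int (j + 1) * int (schroeder_coeff n j) = int (n choose j) * int ((n + j) choose j)" for j
    using Suc_times_schroeder_coeff[of j n] by (metis of_nat_mult)
  \<comment> \<open>The extra factor \<open>k + 1\<close> lets the absorption identities
    \<open>a\<close> and \<open>b\<close> apply to both binomials at once; it is cancelled at the
    end.\<close>
  have "int (k + 1) * (int ((k + 1) * (k + 2)) * int (schroeder_coeff n (k + 1))) =
      int (k + 1) * int (k + 1) * (int (k + 1 + 1) * int (schroeder_coeff n (k + 1)))"
    by (simp add: algebra_simps)
  also have "\<dots> = (int (k + 1) * int (n choose (k + 1))) *
      (int (k + 1) * int ((n + (k + 1)) choose (k + 1)))"
    unfolding c by (simp only: mult_ac)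
  also have "\<dots> = (int n - int k) * (int n + int k + 1) *
      (int (n choose k) * int ((n + k) choose k))"
    unfolding a b by (simp only: mult_ac)
  also have "\<dots> = int (k + 1) *
      ((int n - int k) * (int n + int k + 1) * int (schroeder_coeff n k))"
    unfolding c[symmetric] by (simp only: mult_ac)
  finally show ?thesis by simp
qed

text \<open>The multiplier \<open>(n - k) (n + k + 1) = n (n + 1) - k (k + 1)\<close> is unchanged
  modulo \<open>p\<close> under \<open>n \<mapsto> -1 - n\<close>. The bound on \<open>k\<close>
  keeps the factors \<open>k + 1\<close> and \<open>k + 2\<close> of the recurrence below
  \<open>p\<close>, hence invertible; for \<open>n = 0\<close> the claim already fails at
  \<open>k = p - 1\<close>.\<close>

lemma schroeder_coeff_reflect:
  assumes "prime p" and "n < p" and "k + 2 \<le> p"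
  shows "[int (schroeder_coeff (p - 1 - n) k) = int (schroeder_coeff n k)] (mod int p)"
  using assms(3)
proof (induction k)
  case (Suc k)
  define m where "m = p - 1 - n"
  have m: "int m = int p - 1 - int n" using assms(2) by (simp add: m_def of_nat_diff)
  have "(int m - int k) * (int m + int k + 1) - (int n - int k) * (int n + int k + 1)
      = int p * (int p - 2 * int n - 1)"
    unfolding m by (simp add: algebra_simps)
  then have "[(int m - int k) * (int m + int k + 1) = (int n - int k) * (int n + int k + 1)] (mod int p)"
    by (simp add: cong_iff_dvd_diff)
  then have "[int ((k + 1) * (k + 2)) * int (schroeder_coeff m (k + 1)) =
      int ((k + 1) * (k + 2)) * int (schroeder_coeff n (k + 1))] (mod int p)"
    unfolding schroeder_coeff_rec by (rule cong_mult) (use Suc in \<open>simp add: m_def\<close>)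
  moreover have "\<not> p dvd (k + 1) * (k + 2)"
    using assms(1) Suc.prems by (auto simp only: prime_dvd_mult_iff dest!: dvd_imp_le)
  then have "coprime (int ((k + 1) * (k + 2))) (int p)"
    using assms(1) by (metis coprime_commute coprime_int_iff prime_imp_coprime)
  ultimately show ?case by (simp add: cong_mult_lcancel m_def)
qed simp

section \<open>The top coefficient of index \<open>p - 1\<close> and Fermat's theorem\<close>

lemma central_binomial_cong_1:
  assumes "prime p"
  shows "[(2 * p - 1) choose (p - 1) = 1] (mod p)"
proof -
  have p: "p > 0" using assms by (rule prime_gt_0_nat)
  have "(2 * p - 1) choose (p - 1) = (p + (p - 1)) choose (p - 1)"
    using p by (simp add: mult_2)
  also have "\<dots> = (\<Sum>k\<le>p - 1. (p choose k) * ((p - 1) choose (p - 1 - k)))"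
    by (rule vandermonde[symmetric])
  also have "\<dots> = 1 + (\<Sum>k\<in>{0<..p - 1}. (p choose k) * ((p - 1) choose (p - 1 - k)))"
    by (subst atMost_atLeast0, subst sum.head) simp_all
  finally have eq: "(2 * p - 1) choose (p - 1) =
      1 + (\<Sum>k\<in>{0<..p - 1}. (p choose k) * ((p - 1) choose (p - 1 - k)))" .
  have "p dvd (\<Sum>k\<in>{0<..p - 1}. (p choose k) * ((p - 1) choose (p - 1 - k)))"
    using assms p by (intro dvd_sum dvd_mult2 dvd_choose_prime) auto
  then show ?thesis
    unfolding eq by (metis cong_add_lcancel_0_nat cong_0_iff)
qed

text \<open>Since \<open>p * c\<close> is a central binomial coefficient, \<open>p\<close> must be
  cancelled before reducing. Multiplying by \<open>2 * p - 1\<close>, which is \<open>-1\<close>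
  modulo \<open>p\<close>, makes this possible and leaves a binomial coefficient congruent to
  \<open>1\<close>.\<close>

lemma schroeder_coeff_top_cong:
  assumes "prime p"
  shows "[int (schroeder_coeff (p - 1) (p - 1)) = -1] (mod int p)"
proof -
  define c where "c = schroeder_coeff (p - 1) (p - 1)"
  have p: "p > 0" using assms by (rule prime_gt_0_nat)
  have "p * c = (2 * p - 2) choose (p - 1)"
    using Suc_times_schroeder_coeff[of "p - 1" "p - 1"] p
    by (simp add: c_def mult_2 numeral_2_eq_2)
  then have "p * ((2 * p - 1) * c) = (2 * p - 1) * ((2 * p - 2) choose (p - 1))"
    by (metis mult.left_commute)
  also have "\<dots> = p * ((2 * p - 1) choose p)"
    using p Suc_times_binomial_eq[of "2 * p - 2" "p - 1"]
    by (simp add: Suc_diff_Suc numeral_2_eq_2 mult.commute)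
  also have "(2 * p - 1) choose p = (2 * p - 1) choose (p - 1)"
    using p by (subst binomial_symmetric) auto
  finally have "(2 * p - 1) * c = (2 * p - 1) choose (p - 1)" using p by simp
  then have "[int ((2 * p - 1) * c) = 1] (mod int p)"
    using central_binomial_cong_1[OF assms] by (metis cong_int_iff of_nat_1)
  moreover have "int ((2 * p - 1) * c) = - int c + int p * (2 * int c)"
    using p by (simp add: of_nat_diff algebra_simps)
  ultimately have "[- int c = 1] (mod int p)"
    by (metis cong_add_lcancel_0 cong_def mod_mult_self2)
  then show ?thesis
    unfolding c_def by (metis cong_minus_minus_iff minus_minus)
qed

lemma fermat_theorem_int:
  fixes z :: int
  assumes "prime p" and "coprime (int p) z"
  shows "[z ^ (p - 1) = 1] (mod int p)"
proof -
  define a where "a = nat (z mod int p)"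
  have "int a = z mod int p"
    using prime_gt_0_nat[OF assms(1)] by (simp add: a_def)
  then have a: "[int a = z] (mod int p)" by (simp add: cong_def)
  have "\<not> p dvd a"
  proof
    assume "p dvd a"
    then have "int p dvd z"
      using a by (metis cong_dvd_iff dvd_refl cong_dvd_modulus of_nat_dvd_iff)
    then show False
      using assms by (metis coprime_absorb_left not_prime_unit prime_nat_int_transfer)
  qed
  then have "[a ^ (p - 1) = 1] (mod p)" using assms(1) by (intro fermat_theorem)
  then have "[int a ^ (p - 1) = 1] (mod int p)" by (metis cong_int_iff of_nat_1 of_nat_power)
  with cong_pow[OF a] show ?thesis by (metis cong_sym cong_trans)
qed

section \<open>Values of the large polynomials modulo p\<close>

lemma large_schroeder_0 [simp]: "large_schroeder 0 z = 1"
  by (simp add: large_schroeder_def)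

lemma large_schroeder_reflect:
  assumes "prime p" and "0 < n" and "n < p - 1"
  shows "[large_schroeder (p - 1 - n) z = large_schroeder n z] (mod int p)"
proof -
  have "p - 1 - n \<le> p - 2" "n \<le> p - 2" using assms by auto
  then show ?thesis
    using assms prime_ge_2_nat[OF assms(1)]
    by (simp only: large_schroeder_altdef[of _ "p - 2"])
       (intro cong_sum cong_mult schroeder_coeff_reflect cong_refl; simp)
qed

text \<open>Below the top degree the coefficients agree with those of the constant polynomial of
  index \<open>0\<close>, so the value is congruent to \<open>1 - z ^ (p - 1)\<close>.\<close>

lemma large_schroeder_prime_minus_1:
  assumes "prime p" and "coprime (int p) z"
  shows "[large_schroeder (p - 1) z = 0] (mod int p)"
proof -
  have p: "p \<ge> 2" using assms(1) by (rule prime_ge_2_nat)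
  have "large_schroeder (p - 1) z =
      (\<Sum>k=0..p - 2. int (schroeder_coeff (p - 1) k) * z ^ k)
        + int (schroeder_coeff (p - 1) (p - 1)) * z ^ (p - 1)"
    using p sum.atLeast0_atMost_Suc[of "\<lambda>k. int (schroeder_coeff (p - 1) k) * z ^ k" "p - 2"]
    by (simp only: large_schroeder_altdef[OF order_refl] numeral_2_eq_2 Suc_diff_Suc
        Suc_le_eq diff_Suc_1 One_nat_def)
  also have "[\<dots> = large_schroeder 0 z + (-1) * 1] (mod int p)"
  proof (intro cong_add cong_mult)
    show "[(\<Sum>k=0..p - 2. int (schroeder_coeff (p - 1) k) * z ^ k) = large_schroeder 0 z] (mod int p)"
      unfolding large_schroeder_altdef[of 0 "p - 2", OF le0]
      using schroeder_coeff_reflect[OF assms(1), of 0] p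
      by (intro cong_sum cong_mult) auto
    show "[int (schroeder_coeff (p - 1) (p - 1)) = - 1] (mod int p)"
      using assms(1) by (rule schroeder_coeff_top_cong)
    show "[z ^ (p - 1) = 1] (mod int p)"
      using assms by (rule fermat_theorem_int)
  qed
  finally show ?thesis by simp
qed

section \<open>From little to large polynomials\<close>

lemma large_schroeder_eq_little_schroeder:
  assumes "n > 0"
  shows "large_schroeder n z = (z + 1) * little_schroeder n z"
proof -
  \<comment> \<open>The indicator is essential: for \<open>m < j\<close> truncated subtraction would
    give a binomial coefficient \<open>1\<close> instead of \<open>0\<close>.\<close>
  have expand: "z ^ j * (z + 1) ^ (n - j) = (\<Sum>m=0..n. int ((n - j) choose (m - j)) * of_bool (j \<le> m) * z ^ m)"
    if "j \<le> n" for j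
  proof -
    have "z ^ j * (z + 1) ^ (n - j) = (\<Sum>i\<le>n - j. int ((n - j) choose i) * z ^ (j + i))"
      by (simp add: binomial_ring sum_distrib_left power_add mult_ac)
    also have "\<dots> = (\<Sum>m\<in>{j..n}. int ((n - j) choose (m - j)) * z ^ m)"
      using that by (intro sum.reindex_bij_witness[of _ "\<lambda>m. m - j" "\<lambda>i. j + i"]) auto
    also have "\<dots> = (\<Sum>m=0..n. int ((n - j) choose (m - j)) * of_bool (j \<le> m) * z ^ m)"
      by (intro sum.mono_neutral_cong_left) auto
    finally show ?thesis .
  qed
  \<comment> \<open>Trinomial revision pulls out \<open>n choose m\<close>, which does not depend on
    \<open>j\<close>; the rest is a Vandermonde convolution.\<close>
  have coeff: "(\<Sum>j<n. (n choose (j + 1)) * (n choose j) * (((n - j) choose (m - j)) * of_bool (j \<le> m)))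
      = n * schroeder_coeff n m" if "m \<le> n" for m
  proof -
    have "(\<Sum>j<n. (n choose (j + 1)) * (n choose j) * (((n - j) choose (m - j)) * of_bool (j \<le> m)))
        = (\<Sum>j<n. (n choose m) * ((m choose j) * (n choose (n - 1 - j))))"
    proof (intro sum.cong refl)
      fix j assume "j \<in> {..<n}"
      then have "n choose (j + 1) = n choose (n - 1 - j)"
        by (subst binomial_symmetric) auto
      moreover have "(n choose j) * (((n - j) choose (m - j)) * of_bool (j \<le> m)) = (n choose m) * (m choose j)"
        using choose_mult[of j m n] that by (cases "j \<le> m") (auto simp: binomial_eq_0)
      ultimately show "(n choose (j + 1)) * (n choose j) * (((n - j) choose (m - j)) * of_bool (j \<le> m))
          = (n choose m) * ((m choose j) * (n choose (n - 1 - j)))"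
        by (metis mult.assoc mult.commute)
    qed
    also have "\<dots> = (n choose m) * (\<Sum>j\<le>n - 1. (m choose j) * (n choose (n - 1 - j)))"
      using assms by (simp add: sum_distrib_left lessThan_Suc_atMost[symmetric])
    also have "(\<Sum>j\<le>n - 1. (m choose j) * (n choose (n - 1 - j))) = (m + n) choose (n - 1)"
      by (rule vandermonde)
    also have "\<dots> = (n + m) choose (m + 1)"
      using assms by (subst binomial_symmetric) (auto simp: add.commute)
    finally have eq: "(\<Sum>j<n. (n choose (j + 1)) * (n choose j) * (((n - j) choose (m - j)) * of_bool (j \<le> m)))
        = (n choose m) * ((n + m) choose (m + 1))" .
    have "(m + 1) * ((n + m) choose (m + 1)) = n * ((n + m) choose m)"
      using binomial_absorb_comp[of "n + m" m] binomial_absorption[of m "n + m"] by simp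
    then have "(m + 1) * ((n choose m) * ((n + m) choose (m + 1))) = (m + 1) * (n * schroeder_coeff n m)"
      using Suc_times_schroeder_coeff[of m n] by (metis mult.left_commute)
    then show ?thesis unfolding eq by (subst (asm) mult_cancel1) simp
  qed
  \<comment> \<open>The factor \<open>n\<close> clears the division, and \<open>z + 1\<close> raises
    the exponent \<open>n - k\<close> to \<open>n - j\<close> with \<open>j = k - 1\<close>, the
    form required by \<open>expand\<close>.\<close>
  have "int n * ((z + 1) * little_schroeder n z) =
      (\<Sum>k=1..n. int ((n choose k) * (n choose (k - 1))) * (z ^ (k - 1) * (z + 1) ^ (n - (k - 1))))"
  proof -
    have "int n * ((z + 1) * (int ((n choose k) * (n choose (k - 1)) div n) * z ^ (k - 1) * (z + 1) ^ (n - k)))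
        = int ((n choose k) * (n choose (k - 1))) * (z ^ (k - 1) * (z + 1) ^ (n - (k - 1)))"
      if "k \<in> {1..n}" for k
    proof -
      have "n * ((n choose k) * (n choose (k - 1)) div n) = (n choose k) * (n choose (k - 1))"
        using little_schroeder_coeff_exact[of k n] that by (intro dvd_mult_div_cancel) simp
      moreover have "(z + 1) ^ (n - (k - 1)) = (z + 1) * (z + 1) ^ (n - k)"
        using that by (simp flip: power_Suc)  (simp add: Suc_diff_le)
      ultimately show ?thesis by (metis mult.assoc mult.left_commute of_nat_mult)
    qed
    then show ?thesis
      using assms by (simp only: little_schroeder_def sum_distrib_left if_False neq0_conv[symmetric]
          cong: sum.cong)
  qed
  also have "\<dots> = (\<Sum>j<n. int ((n choose (j + 1)) * (n choose j)) * (z ^ j * (z + 1) ^ (n - j)))"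
    by (intro sum.reindex_bij_witness[of _ "\<lambda>j. j + 1" "\<lambda>k. k - 1"]) auto
  also have "\<dots> = (\<Sum>j<n. \<Sum>m=0..n. int ((n choose (j + 1)) * (n choose j) *
      (((n - j) choose (m - j)) * of_bool (j \<le> m))) * z ^ m)"
    by (intro sum.cong refl) (simp add: expand sum_distrib_left mult_ac)
  also have "\<dots> = (\<Sum>m=0..n. int (\<Sum>j<n. (n choose (j + 1)) * (n choose j) *
      (((n - j) choose (m - j)) * of_bool (j \<le> m))) * z ^ m)"
    by (subst sum.swap) (simp add: sum_distrib_right)
  also have "\<dots> = int n * large_schroeder n z"
    unfolding large_schroeder_altdef[OF order_refl] sum_distrib_left
    by (intro sum.cong refl) (subst coeff, simp_all)
  finally show ?thesis using assms by simp
qed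

theorem theorem1p1:
  fixes p r :: nat and \<epsilon> z :: int
  assumes "prime p" and "odd p"
    and "\<epsilon> \<in> {-1, 1}"
    and "gcd (int p) (z * (z + 1)) = 1"
  shows "[(\<Sum>k=0..p-1. (2 * int k + 1) ^ (2 * r + 1) * \<epsilon> ^ k * large_schroeder k z) = 1] (mod int p)
    \<and> [(\<Sum>k=0..p-1. (2 * int k + 1) ^ (2 * r + 1) * \<epsilon> ^ k * little_schroeder k z) = 0] (mod int p)"
proof -
  define w where "w k = (2 * int k + 1) ^ (2 * r + 1) * \<epsilon> ^ k" for k
  have p: "p \<ge> 3" using assms(1,2) prime_ge_2_nat[OF assms(1)] by (cases "p = 2") auto
  have "coprime (int p) (z * (z + 1))" using assms(4) by (simp add: coprime_iff_gcd_eq_1)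
  then have cop: "coprime (int p) z" "coprime (int p) (z + 1)" by simp_all
  have split: "(\<Sum>k=0..p-1. f k) = f 0 + (\<Sum>k=1..p-2. f k) + f (p - 1)" for f :: "nat \<Rightarrow> int"
  proof -
    have "{0..p-1} = insert 0 (insert (p - 1) {1..p-2})" using p by auto
    moreover have "0 \<notin> insert (p - 1) {1..p-2}" "p - 1 \<notin> {1..p-2}" using p by auto
    ultimately show ?thesis by (simp only: sum.insert finite_insert finite_atLeastAtMost add_ac
        not_False_eq_True)
  qed
  have w0: "w 0 = 1" by (simp add: w_def)
  \<comment> \<open>The odd exponent preserves the sign change of \<open>2 * k + 1\<close>, while
    \<open>\<epsilon> ^ k\<close> keeps its value because \<open>p - 1\<close> is even.\<close>
  have w_reflect: "[w (p - 1 - k) = - w k] (mod int p)" if "k \<le> p - 1" for k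
  proof -
    have "[2 * int (p - 1 - k) + 1 = - (2 * int k + 1)] (mod int p)"
      using that p by (simp add: of_nat_diff cong_iff_dvd_diff)
    then have "[(2 * int (p - 1 - k) + 1) ^ (2 * r + 1) = (- (2 * int k + 1)) ^ (2 * r + 1)] (mod int p)"
      by (rule cong_pow)
    moreover have "(- (2 * int k + 1)) ^ (2 * r + 1) = - ((2 * int k + 1) ^ (2 * r + 1))"
      by (rule power_minus_odd) simp
    moreover have "\<epsilon> ^ (p - 1 - k) = \<epsilon> ^ k"
      using assms(2,3) that p by (auto simp: minus_one_power_iff)
    ultimately show ?thesis unfolding w_def by (metis cong_scalar_right mult_minus_left)
  qed
  \<comment> \<open>Reflection gives \<open>M \<equiv> - M\<close>, and \<open>2\<close> is
    invertible modulo the odd prime \<open>p\<close>.\<close>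
  define M where "M = (\<Sum>k=1..p-2. w k * large_schroeder k z)"
  have "M = (\<Sum>k=1..p-2. w (p - 1 - k) * large_schroeder (p - 1 - k) z)"
    unfolding M_def using p
    by (intro sum.reindex_bij_witness[of _ "\<lambda>k. p - 1 - k" "\<lambda>k. p - 1 - k"]) auto
  also have "[\<dots> = (\<Sum>k=1..p-2. - w k * large_schroeder k z)] (mod int p)"
    using assms(1) p by (intro cong_sum cong_mult w_reflect large_schroeder_reflect) auto
  also have "(\<Sum>k=1..p-2. - w k * large_schroeder k z) = - M"
    by (simp add: M_def sum_negf)
  finally have "int p dvd 2 * M" by (simp add: cong_iff_dvd_diff)
  moreover have "coprime (int p) 2" using assms(2) by simp
  ultimately have M: "[M = 0] (mod int p)"
    by (simp add: coprime_dvd_mult_right_iff cong_0_iff)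
  have top: "[w (p - 1) * large_schroeder (p - 1) z = 0] (mod int p)"
    using large_schroeder_prime_minus_1[OF assms(1) cop(1)] by (simp add: cong_0_iff)
  have "[(\<Sum>k=0..p-1. w k * large_schroeder k z) = 1 + 0 + 0] (mod int p)"
    unfolding split M_def[symmetric] using M top by (intro cong_add) (auto simp: w0)
  then have large: "[(\<Sum>k=0..p-1. w k * large_schroeder k z) = 1] (mod int p)" by simp
  \<comment> \<open>The term of index \<open>0\<close>, which contributes the \<open>1\<close> to
    the large sum, is zero here; the remaining terms become those of the large sum. The factor
    \<open>z + 1\<close> is coprime to \<open>p\<close> and cancels afterwards.\<close>
  have "(z + 1) * (\<Sum>k=0..p-1. w k * little_schroeder k z) =
      M + w (p - 1) * large_schroeder (p - 1) z"
    unfolding split M_def using p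
    by (simp add: little_schroeder_0 large_schroeder_eq_little_schroeder algebra_simps sum_distrib_left)
  also have "[\<dots> = 0 + 0] (mod int p)" using M top by (rule cong_add)
  finally have "[(\<Sum>k=0..p-1. w k * little_schroeder k z) = 0] (mod int p)"
    using cop(2) by (simp add: cong_0_iff coprime_dvd_mult_right_iff)
  with large show ?thesis by (simp add: w_def)
qed

end
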